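(* Let $R=\mathbb{C}[x_1,\dots,x_n]$, let $\sigma$ be a term ordering, and let $I\subset R$ be a zerodimensional primary ideal with $\mathcal{V}(I)=\{(0,\dots,0)\}$. Let $\mathcal{G}=\{g_1,\dots,g_t\}$ be a $\sigma$-Gröbner basis of $I$. Then the following procedure, with input $\mathcal{G}$, computes the noetherian operators associated to $I$: its output consists of $\mu=\dim_{\mathbb{C}}(R/I)$ operators, which form a $\mathbb{C}$-basis of $\Delta(I)$ and are a set of noetherian operators for $I$. (1) Compute $\mu=\mu(I)=\dim_{\mathbb{C}}(R/I)$. (2) Write the Taylor expansion at the origin, up to degree $\mu-1$, of a generic polynomial $h\in R$: $$T_{\mu-1}h=\sum_{\alpha\in\mathbb{N}^n,\ |\alpha|<\mu}c_\alpha x_1^{\alpha_1}\cdots x_n^{\alpha_n},$$ with the coefficients $c_\alpha$ treated as undetermined elements of $\mathbb{C}$. (3) Write the normal form of $T_{\mu-1}h$ with respect to $\mathcal{G}$ as $$\mathrm{NF}_\sigma(T_{\mu-1}h)=\sum_\beta d_\beta x_1^{\beta_1}\cdots x_n^{\beta_n},$$ and find scalars $a_{\beta\alpha}\in\mathbb{C}$ such that $d_\beta=\sum_\alpha a_{\beta\alpha}c_\alpha$ (as linear forms in the $c_\alpha$). (4) For each $\beta$ such that $d_\beta\neq 0$ (as a linear form in the $c_\alpha$), return the operator $$L_\beta=\sum_\alpha a_{\beta\alpha}\,\frac{1}{\alpha_1!\cdots\alpha_n!}\,\partial_{x_1}^{\alpha_1}\cdots\partial_{x_n}^{\alpha_n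}.$$
   Context: $\mathcal{V}(I)\subset\mathbb{C}^n$ is the zero set of $I$. A term ordering is a total ordering on the monoid $\mathbb{T}^n$ of power products of $x_1,\dots,x_n$, compatible with multiplication and for which $1$ is the smallest element. $\mathrm{NF}_\sigma(f)$ denotes the normal form of $f$, i.e. the remainder of $f$ upon division by a $\sigma$-Gröbner basis of $I$. The normal form is $\mathbb{C}$-linear in $f$, so it makes sense for a polynomial with undetermined coefficients $c_\alpha$, and the $d_\beta$ are then linear forms in the $c_\alpha$. For $(i_1,\dots,i_n)\in\mathbb{N}^n$ put $D(i_1,\dots,i_n)=\frac{1}{i_1!\cdots i_n!}\partial_{x_1}^{i_1}\cdots\partial_{x_n}^{i_n}:R\to R$, let $\mathcal{D}$ be the set of all these operators, and let $\mathrm{Span}_{\mathbb{C}}(\mathcal{D})$ be the $\mathbb{C}$-vector space they generate. Then $$\Delta(I)=\{L\in\mathrm{Span}_{\mathbb{C}}(\mathcal{D})\mid L(f)(0,\dots,0)=0\text{ for all }f\in I\}.$$ A set of operators $L_1,\dots,L_\mu$ is a set of noetherian operators for such an $I$ if, for every $f\in R$, one has $f\in I$ if and only if $L_j(f)(0,\dots,0)=0$ for all $j$. *)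

theory Defs
  imports Complex_Main "HOL-Library.Poly_Mapping" "HOL-Library.Function_Algebras"
begin

text \<open>
  The finite type \<open>'n\<close> indexes the variables, so \<open>n = CARD('n)\<close>. Power products, and likewise
  multi-indices in \<open>\<nat>\<^sup>n\<close>, are maps \<open>'n \<Rightarrow>\<^sub>0 nat\<close>; the monoid of power products is written
  additively, so the power product \<open>1\<close> is \<open>0\<close>.
\<close>

type_synonym 'n pp = "'n \<Rightarrow>\<^sub>0 nat"
type_synonym 'n mpoly = "'n pp \<Rightarrow>\<^sub>0 complex"

definition total_deg :: "'n::finite pp \<Rightarrow> nat" where
  "total_deg t = (\<Sum>x\<in>UNIV. Poly_Mapping.lookup t x)"

definition pscale :: "complex \<Rightarrow> 'n mpoly \<Rightarrow> 'n mpoly" where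
  "pscale c f = Poly_Mapping.single 0 c * f"

definition eval :: "('n::finite \<Rightarrow> complex) \<Rightarrow> 'n mpoly \<Rightarrow> complex" where
  "eval a f =
     (\<Sum>t\<in>Poly_Mapping.keys f. Poly_Mapping.lookup f t * (\<Prod>x\<in>UNIV. a x ^ Poly_Mapping.lookup t x))"

interpretation ideal: module "(*) :: 'n mpoly \<Rightarrow> 'n mpoly \<Rightarrow> 'n mpoly"
  by standard (simp_all add: algebra_simps)

interpretation poly: vector_space "pscale :: complex \<Rightarrow> 'n mpoly \<Rightarrow> 'n mpoly"
  by standard (simp_all add: pscale_def distrib_left distrib_right single_add mult_single flip: mult.assoc)


subsection \<open>Ideals\<close>

definition primary_ideal :: "'n mpoly set \<Rightarrow> bool" where
  "primary_ideal I \<longleftrightarrow> ideal.subspace I \<and> I \<noteq> UNIV \<and>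
     (\<forall>f g. f * g \<in> I \<longrightarrow> f \<in> I \<or> (\<exists>k. g ^ k \<in> I))"

definition zero_set :: "'n::finite mpoly set \<Rightarrow> ('n \<Rightarrow> complex) set" where
  "zero_set I = {a. \<forall>f\<in>I. eval a f = 0}"

text \<open>
  The residue classes of the elements of \<open>B\<close> are pairwise distinct and form a finite
  \<open>\<complex>\<close>-basis of \<open>R/I\<close> (distinctness follows from the independence clause).
\<close>

definition quotient_basis :: "'n mpoly set \<Rightarrow> 'n mpoly set \<Rightarrow> bool" where
  "quotient_basis I B \<longleftrightarrow> finite B \<and>
     (\<forall>f. \<exists>c. f - (\<Sum>b\<in>B. pscale (c b) b) \<in> I) \<and>
     (\<forall>c. (\<Sum>b\<in>B. pscale (c b) b) \<in> I \<longrightarrow> (\<forall>b\<in>B. c b = 0))"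

definition zero_dimensional :: "'n mpoly set \<Rightarrow> bool" where
  "zero_dimensional I \<longleftrightarrow> (\<exists>B. quotient_basis I B)"

definition quotient_dim :: "'n mpoly set \<Rightarrow> nat" where
  "quotient_dim I = (THE m. \<exists>B. quotient_basis I B \<and> card B = m)"


subsection \<open>Term orderings, Groebner bases and normal forms\<close>

text \<open>\<open>(s, t) \<in> \<sigma>\<close> means \<open>s \<le>\<^sub>\<sigma> t\<close>.\<close>

definition term_ordering :: "'n pp rel \<Rightarrow> bool" where
  "term_ordering \<sigma> \<longleftrightarrow> linear_order \<sigma> \<and>
     (\<forall>s t u. (s, t) \<in> \<sigma> \<longrightarrow> (s + u, t + u) \<in> \<sigma>) \<and> (\<forall>t. (0, t) \<in> \<sigma>)"

text \<open>The leading power product; only meaningful for \<open>f \<noteq> 0\<close>.\<close>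

definition lead_pp :: "'n pp rel \<Rightarrow> 'n mpoly \<Rightarrow> 'n pp" where
  "lead_pp \<sigma> f =
     (THE t. t \<in> Poly_Mapping.keys f \<and> (\<forall>s\<in>Poly_Mapping.keys f. (s, t) \<in> \<sigma>))"

definition lead_ideal :: "'n pp rel \<Rightarrow> 'n mpoly set \<Rightarrow> 'n mpoly set" where
  "lead_ideal \<sigma> F = ideal.span {Poly_Mapping.single (lead_pp \<sigma> f) 1 | f. f \<in> F \<and> f \<noteq> 0}"

definition groebner_basis :: "'n pp rel \<Rightarrow> 'n mpoly set \<Rightarrow> 'n mpoly set \<Rightarrow> bool" where
  "groebner_basis \<sigma> I G \<longleftrightarrow> finite G \<and> G \<subseteq> I \<and> 0 \<notin> G \<and> lead_ideal \<sigma> G = lead_ideal \<sigma> I"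

definition division_remainder :: "'n pp rel \<Rightarrow> 'n mpoly set \<Rightarrow> 'n mpoly \<Rightarrow> 'n mpoly \<Rightarrow> bool" where
  "division_remainder \<sigma> G f r \<longleftrightarrow>
     (\<exists>q. f = (\<Sum>g\<in>G. q g * g) + r \<and>
          (\<forall>g\<in>G. q g * g \<noteq> 0 \<longrightarrow> f \<noteq> 0 \<and> (lead_pp \<sigma> (q g * g), lead_pp \<sigma> f) \<in> \<sigma>)) \<and>
     (\<forall>t\<in>Poly_Mapping.keys r. \<forall>g\<in>G. \<nexists>u. t = lead_pp \<sigma> g + u)"

text \<open>The remainder is unique because \<open>G\<close> is always a Groebner basis below.\<close>

definition normal_form :: "'n pp rel \<Rightarrow> 'n mpoly set \<Rightarrow> 'n mpoly \<Rightarrow> 'n mpoly" where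
  "normal_form \<sigma> G f = (THE r. division_remainder \<sigma> G f r)"


subsection \<open>Differential operators\<close>

definition partial :: "'n \<Rightarrow> 'n mpoly \<Rightarrow> 'n mpoly" where
  "partial x f =
     (\<Sum>t\<in>Poly_Mapping.keys f. Poly_Mapping.single (t - Poly_Mapping.single x 1)
        (of_nat (Poly_Mapping.lookup t x) * Poly_Mapping.lookup f t))"

lemma lookup_partial:
  "Poly_Mapping.lookup (partial x f) t =
     of_nat (Suc (Poly_Mapping.lookup t x)) * Poly_Mapping.lookup f (t + Poly_Mapping.single x 1)"
proof -
  let ?e = "Poly_Mapping.single x (1::nat)"
  have shift: "s = t + ?e" if "s - ?e = t" "Poly_Mapping.lookup s x \<noteq> 0" for s
  proof (rule poly_mapping_eqI)
    fix y
    from that(1) have "Poly_Mapping.lookup (s - ?e) y = Poly_Mapping.lookup t y" by simp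
    with that(2) show "Poly_Mapping.lookup s y = Poly_Mapping.lookup (t + ?e) y"
      by (cases "x = y") (auto simp: lookup_minus lookup_add lookup_single)
  qed
  have "Poly_Mapping.lookup (partial x f) t =
      (\<Sum>s\<in>Poly_Mapping.keys f. if s = t + ?e
        then of_nat (Poly_Mapping.lookup s x) * Poly_Mapping.lookup f s else 0)"
    unfolding partial_def lookup_sum
    by (rule sum.cong) (use shift in \<open>auto simp: lookup_single when_def\<close>)
  also have "\<dots> = of_nat (Suc (Poly_Mapping.lookup t x)) * Poly_Mapping.lookup f (t + ?e)"
    by (auto simp: sum.delta lookup_add in_keys_iff)
  finally show ?thesis .
qed

lemma partial_commute: "partial x (partial y f) = partial y (partial x f)"
  by (rule poly_mapping_eqI)
     (auto simp: lookup_partial lookup_add lookup_single algebra_simps when_def)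

text \<open>
  The composite of the powers \<open>\<partial>\<^sub>x\<^bsup>i x\<^esup>\<close> over all variables \<open>x\<close>; by the next lemma the order of
  composition does not matter, so the fold is well defined.
\<close>

definition iter_partial :: "'n::finite pp \<Rightarrow> 'n mpoly \<Rightarrow> 'n mpoly" where
  "iter_partial i f = Finite_Set.fold (\<lambda>x. partial x ^^ Poly_Mapping.lookup i x) f UNIV"

lemma comp_fun_commute_partial: "comp_fun_commute (\<lambda>x. partial x ^^ k x)"
proof
  fix x y :: 'a
  have *: "partial x ((partial y ^^ m) f) = (partial y ^^ m) (partial x f)" for m f
    by (induction m) (simp_all, metis partial_commute)
  have "(partial x ^^ l) ((partial y ^^ m) f) = (partial y ^^ m) ((partial x ^^ l) f)" for l m f
    by (induction l) (simp_all add: *)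
  then show "(partial y ^^ k y) \<circ> (partial x ^^ k x) = (partial x ^^ k x) \<circ> (partial y ^^ k y)"
    by (simp add: fun_eq_iff)
qed

type_synonym 'n operator = "'n mpoly \<Rightarrow> 'n mpoly"

definition D :: "'n::finite pp \<Rightarrow> 'n operator" where
  "D i f = pscale (1 / (\<Prod>x\<in>UNIV. fact (Poly_Mapping.lookup i x))) (iter_partial i f)"

text \<open>Operators form a complex vector space under the pointwise operations.\<close>

definition oscale :: "complex \<Rightarrow> 'n operator \<Rightarrow> 'n operator" where
  "oscale c L = (\<lambda>f. pscale c (L f))"

interpretation oper: vector_space "oscale :: complex \<Rightarrow> 'n operator \<Rightarrow> 'n operator"
  by standard
     (simp_all add: oscale_def fun_eq_iff poly.scale_right_distrib poly.scale_left_distrib)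

definition diff_ops :: "'n::finite operator set" where
  "diff_ops = oper.span (range D)"

definition Delta :: "'n::finite mpoly set \<Rightarrow> 'n operator set" where
  "Delta I = {L \<in> diff_ops. \<forall>f\<in>I. eval (\<lambda>_. 0) (L f) = 0}"

definition noetherian_operators :: "'n::finite mpoly set \<Rightarrow> 'n operator set \<Rightarrow> bool" where
  "noetherian_operators I S \<longleftrightarrow> finite S \<and> S \<subseteq> diff_ops \<and>
     (\<forall>f. f \<in> I \<longleftrightarrow> (\<forall>L\<in>S. eval (\<lambda>_. 0) (L f) = 0))"


subsection \<open>The procedure\<close>

text \<open>
  Undetermined coefficients are modelled by arbitrary values \<open>c :: 'n pp \<Rightarrow> complex\<close>, and a linear
  form in them by the corresponding function of \<open>c\<close>.
\<close>

definition generic_taylor :: "nat \<Rightarrow> ('n::finite pp \<Rightarrow> complex) \<Rightarrow> 'n mpoly" where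
  "generic_taylor m c = (\<Sum>\<alpha> | total_deg \<alpha> < m. Poly_Mapping.single \<alpha> (c \<alpha>))"

definition nf_coeff ::
  "'n::finite pp rel \<Rightarrow> 'n mpoly set \<Rightarrow> nat \<Rightarrow> 'n pp \<Rightarrow> ('n pp \<Rightarrow> complex) \<Rightarrow> complex" where
  "nf_coeff \<sigma> G m \<beta> c = Poly_Mapping.lookup (normal_form \<sigma> G (generic_taylor m c)) \<beta>"

definition represents_nf ::
  "'n::finite pp rel \<Rightarrow> 'n mpoly set \<Rightarrow> nat \<Rightarrow> ('n pp \<Rightarrow> 'n pp \<Rightarrow> complex) \<Rightarrow> bool" where
  "represents_nf \<sigma> G m a \<longleftrightarrow>
     (\<forall>\<beta> c. nf_coeff \<sigma> G m \<beta> c = (\<Sum>\<alpha> | total_deg \<alpha> < m. a \<beta> \<alpha> * c \<alpha>))"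

definition output_index :: "'n::finite pp rel \<Rightarrow> 'n mpoly set \<Rightarrow> nat \<Rightarrow> 'n pp set" where
  "output_index \<sigma> G m = {\<beta>. \<exists>c. nf_coeff \<sigma> G m \<beta> c \<noteq> 0}"

definition output_op ::
  "nat \<Rightarrow> ('n::finite pp \<Rightarrow> 'n pp \<Rightarrow> complex) \<Rightarrow> 'n pp \<Rightarrow> 'n operator" where
  "output_op m a \<beta> = (\<Sum>\<alpha> | total_deg \<alpha> < m. oscale (a \<beta> \<alpha>) (D \<alpha>))"

end

(*
  Modulo I every monomial of degree at least \<mu> vanishes: otherwise a chain of \<mu> + 1 monomials
  dividing it would be linearly dependent modulo I, and factoring the lowest monomial out of a
  relation leaves a cofactor with nonzero constant term; since I is primary and its elements vanish
  at the origin, that monomial would lie in I. So truncating f at degree \<mu> does not change its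
  normal form, and L\<^sub>\<beta>(f)(0) is the coefficient of x^\<beta> in NF(f). As the standard monomials form a
  basis of R/I, the L\<^sub>\<beta> are its dual basis.
*)
theory Submission
  imports Defs
begin

text \<open>Operators are maps from R to R, but \<open>Delta\<close> and
  \<open>noetherian_operators\<close> see only the functional sending f to L(f)(0). Nothing is lost:
  \<open>D \<alpha>\<close> followed by evaluation at the origin is the coefficient functional of
  x^\<alpha>, so the functional determines the coefficients of L and hence L. Independence and
  spanning can therefore be checked at the origin. An element of \<open>Delta I\<close> may have any
  order, while the L_\<beta> have order below \<mu>. The gap closes because a functional that kills
  I factors through R/I and is determined by its values on the standard monomials.
  \<open>normal_form\<close> is a definite description of a division remainder, so neither its
  linearity nor its invariance modulo I is immediate. Both come from a characterisation that does
  not mention division: the normal form of f is the only element of f + I supported on standard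
  monomials. Existence of division in turn needs the term ordering to be well-founded, which is
  derived from its axioms by Dickson's lemma.\<close>

section \<open>Coefficients and evaluation at the origin\<close>

lemma lookup_single_mult_add:
  fixes f :: "'n mpoly"
  shows "Poly_Mapping.lookup (Poly_Mapping.single u c * f) (u + t) = c * Poly_Mapping.lookup f t"
  by (simp add: lookup_mult lookup_single when_mult)

lemma lookup_pscale [simp]: "Poly_Mapping.lookup (pscale c f) t = c * Poly_Mapping.lookup f t"
  using lookup_single_mult_add[of 0 c f t] by (simp add: pscale_def)

lemma keys_single_mult_subset:
  fixes f :: "'n mpoly"
  shows "Poly_Mapping.keys (Poly_Mapping.single u c * f) \<subseteq> (+) u ` Poly_Mapping.keys f"
  using keys_mult[of "Poly_Mapping.single u c" f] by (auto split: if_splits)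

lemma pp_add_eq_0_iff: "s + t = 0 \<longleftrightarrow> s = 0 \<and> t = 0" for s t :: "'n pp"
  by (auto simp: poly_mapping_eq_iff fun_eq_iff lookup_add)

text \<open>Exponents are natural numbers, so \<open>l + q = 0\<close> forces both to be 0.
  Multiplicativity of the constant term keeps all powers of a polynomial with nonzero constant term
  out of an ideal that vanishes at the origin.\<close>

lemma lookup_mult_0:
  fixes f g :: "'n mpoly"
  shows "Poly_Mapping.lookup (f * g) 0 = Poly_Mapping.lookup f 0 * Poly_Mapping.lookup g 0"
proof -
  have "(0 = l + q) = (l = 0 \<and> q = 0)" for l q :: "'n pp"
    using pp_add_eq_0_iff[of l q] by metis
  then have "(\<Sum>q. (Poly_Mapping.lookup g q when 0 = l + q)) =
      (Poly_Mapping.lookup g 0 when l = 0)" for l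
    by (cases "l = 0") auto
  then show ?thesis
    by (simp add: lookup_mult mult_when)
qed

lemma lookup_power_0:
  "Poly_Mapping.lookup (f ^ k) 0 = Poly_Mapping.lookup f 0 ^ k" for f :: "'n mpoly"
  by (induction k) (simp_all add: lookup_mult_0)

lemma eval_0: "eval (\<lambda>_. 0) f = Poly_Mapping.lookup f 0" for f :: "'n::finite mpoly"
proof -
  \<comment> \<open>The convention 0 ^ 0 = 1 is what makes the constant term survive.\<close>
  have prod: "(\<Prod>x\<in>UNIV. (0::complex) ^ Poly_Mapping.lookup t x) = (if t = 0 then 1 else 0)" for t :: "'n::finite pp"
    by (auto simp: poly_mapping_eq_iff fun_eq_iff intro!: prod_zero)
  show ?thesis
    unfolding eval_def prod by (simp add: in_keys_iff if_distrib cong: if_cong)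
qed

lemma pscale_eq_single_mult: "pscale c (Poly_Mapping.single t 1) = Poly_Mapping.single t c"
  by (simp add: pscale_def mult_single)

lemma poly_eq_sum_single:
  "f = (\<Sum>t\<in>Poly_Mapping.keys f. Poly_Mapping.single t (Poly_Mapping.lookup f t))" for f :: "'n mpoly"
  by (rule poly_mapping_eqI) (auto simp: lookup_sum lookup_single when_def in_keys_iff)

section \<open>Differential operators as functionals at the origin\<close>

lemma lookup_partial_funpow:
  assumes "Poly_Mapping.lookup t x = 0"
  shows "Poly_Mapping.lookup ((partial x ^^ k) f) t =
    fact k * Poly_Mapping.lookup f (t + Poly_Mapping.single x k)"
proof (induction k arbitrary: f)
  case (Suc k)
  have "t + Poly_Mapping.single x k + Poly_Mapping.single x 1 = t + Poly_Mapping.single x (Suc k)"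
    by (simp add: add.assoc flip: single_add)
  moreover have "Poly_Mapping.lookup ((partial x ^^ Suc k) f) t =
      fact k * Poly_Mapping.lookup (partial x f) (t + Poly_Mapping.single x k)"
    using Suc.IH[of "partial x f"] by (simp add: funpow_swap1)
  ultimately show ?case
    using assms by (simp add: lookup_partial lookup_add algebra_simps)
qed simp

text \<open>Each power of a partial derivative shifts the exponent at which f is read, so t must
  vary in the induction. The shift by \<open>k x\<close> leaves the exponents of the variables still
  to be treated at 0, which is why each variable contributes a plain factorial.\<close>

lemma lookup_fold_partial:
  assumes "finite A" "\<forall>x\<in>A. Poly_Mapping.lookup t x = 0"
  shows "Poly_Mapping.lookup (Finite_Set.fold (\<lambda>x. partial x ^^ k x) f A) t =
    (\<Prod>x\<in>A. fact (k x)) * Poly_Mapping.lookup f (t + (\<Sum>x\<in>A. Poly_Mapping.single x (k x)))"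
  using assms
proof (induction A arbitrary: t rule: finite_induct)
  case (insert x A)
  interpret comp_fun_commute "\<lambda>x. partial x ^^ k x"
    by (rule comp_fun_commute_partial)
  have "\<forall>y\<in>A. Poly_Mapping.lookup (t + Poly_Mapping.single x (k x)) y = 0"
    using insert by (auto simp: lookup_add lookup_single when_def)
  then show ?case
    using insert by (simp add: lookup_partial_funpow add.assoc mult.assoc)
qed simp

text \<open>The normalising factor of \<open>D\<close> cancels exactly the factorials produced by
  differentiation.\<close>

lemma eval_0_D [simp]: "eval (\<lambda>_. 0) (D \<alpha> f) = Poly_Mapping.lookup f \<alpha>"
proof -
  have "(\<Sum>x\<in>UNIV. Poly_Mapping.single x (Poly_Mapping.lookup \<alpha> x)) = \<alpha>"
    by (rule poly_mapping_eqI) (simp add: lookup_sum lookup_single when_def)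
  moreover have "(\<Prod>x\<in>UNIV. fact (Poly_Mapping.lookup \<alpha> x)) \<noteq> (0::complex)"
    by simp
  ultimately show ?thesis
    by (simp add: eval_0 D_def iter_partial_def lookup_fold_partial)
qed

lemma eval_0_oscale [simp]: "eval (\<lambda>_. 0) (oscale c L f) = c * eval (\<lambda>_. 0) (L f)"
  by (simp add: eval_0 oscale_def)

lemma eval_0_sum_op:
  "eval (\<lambda>_. 0) ((\<Sum>j\<in>J. L j) f) = (\<Sum>j\<in>J. eval (\<lambda>_. 0) (L j f))"
  by (induction J rule: infinite_finite_induct) (simp_all add: eval_0 lookup_add)

lemma diff_ops_explicit:
  assumes "L \<in> diff_ops"
  obtains l A where "finite A" "L = (\<Sum>\<alpha>\<in>A. oscale (l \<alpha>) (D \<alpha>))"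
proof -
  obtain T r where T: "finite T" "T \<subseteq> range D" "L = (\<Sum>L\<in>T. oscale (r L) L)"
    using assms unfolding diff_ops_def oper.span_explicit by blast
  \<comment> \<open>Choosing one multi-index for each operator in T allows reindexing without
    knowing that \<open>D\<close> is injective.\<close>
  then obtain A where A: "T = D ` A" "inj_on D A"
    unfolding subset_image_inj by blast
  with T(1) have "finite A"
    by (simp add: finite_image_iff)
  show thesis
    by (rule that[of A "r \<circ> D"]) (use T A \<open>finite A\<close> in \<open>simp_all add: sum.reindex\<close>)
qed

text \<open>Testing on x^\<beta> isolates the coefficient \<open>l \<beta>\<close>. This turns
  identities of functionals at the origin into identities of operators.\<close>

lemma diff_op_eq_0:
  assumes "L \<in> diff_ops" and "\<And>f. eval (\<lambda>_. 0) (L f) = 0"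
  shows "L = 0"
proof -
  from assms(1) obtain l A where L: "finite A" "L = (\<Sum>\<alpha>\<in>A. oscale (l \<alpha>) (D \<alpha>))"
    by (rule diff_ops_explicit)
  have "l \<beta> = 0" if "\<beta> \<in> A" for \<beta>
    using assms(2)[of "Poly_Mapping.single \<beta> 1"] L that
    by (simp add: eval_0_sum_op lookup_single when_def if_distrib cong: if_cong)
  then show ?thesis
    using L by simp
qed

lemma diff_op_at_0_expansion:
  assumes "L \<in> diff_ops"
  shows "eval (\<lambda>_. 0) (L f) = (\<Sum>t\<in>Poly_Mapping.keys f.
    Poly_Mapping.lookup f t * eval (\<lambda>_. 0) (L (Poly_Mapping.single t 1)))"
proof -
  from assms obtain l A where L: "finite A" "L = (\<Sum>\<alpha>\<in>A. oscale (l \<alpha>) (D \<alpha>))"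
    by (rule diff_ops_explicit)
  have L_at_0: "eval (\<lambda>_. 0) (L h) = (\<Sum>\<alpha>\<in>A. l \<alpha> * Poly_Mapping.lookup h \<alpha>)" for h
    using L by (simp add: eval_0_sum_op)
  have "eval (\<lambda>_. 0) (L f) = (\<Sum>\<alpha>\<in>A. l \<alpha> * (\<Sum>t\<in>Poly_Mapping.keys f.
      Poly_Mapping.lookup f t * Poly_Mapping.lookup (Poly_Mapping.single t 1) \<alpha>))"
    by (auto simp: L_at_0 lookup_single when_def if_distrib in_keys_iff cong: if_cong intro!: sum.cong)
  also have "\<dots> = (\<Sum>t\<in>Poly_Mapping.keys f. Poly_Mapping.lookup f t *
      (\<Sum>\<alpha>\<in>A. l \<alpha> * Poly_Mapping.lookup (Poly_Mapping.single t 1) \<alpha>))"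
    by (simp add: sum_distrib_left mult.left_commute sum.swap[of _ A])
  finally show ?thesis
    by (simp add: L_at_0)
qed

lemma diff_op_at_0_diff:
  assumes "L \<in> diff_ops"
  shows "eval (\<lambda>_. 0) (L (f - g)) = eval (\<lambda>_. 0) (L f) - eval (\<lambda>_. 0) (L g)"
proof -
  from assms obtain l A where L: "finite A" "L = (\<Sum>\<alpha>\<in>A. oscale (l \<alpha>) (D \<alpha>))"
    by (rule diff_ops_explicit)
  then show ?thesis
    by (simp add: eval_0_sum_op lookup_minus right_diff_distrib sum_subtractf)
qed

section \<open>Term orderings are well-founded\<close>

text \<open>If s divides t, then s lies below t, because 1 is smallest and multiplication is
  monotone. An infinite descending sequence would contain an earlier member dividing a later
  one.\<close>

lemma term_ordering_wf:
  assumes "term_ordering (\<sigma> :: 'n::finite pp rel)"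
  shows "wf (\<sigma> - Id)"
proof (rule ccontr)
  have comp: "\<And>s t u. (s, t) \<in> \<sigma> \<Longrightarrow> (s + u, t + u) \<in> \<sigma>" and zero: "\<And>t. (0, t) \<in> \<sigma>"
    and lin: "linear_order \<sigma>"
    using assms by (auto simp: term_ordering_def)
  have tr: "trans \<sigma>" and an: "antisym \<sigma>"
    using lin by (auto simp: order_on_defs)
  assume "\<not> wf (\<sigma> - Id)"
  then obtain f where f: "\<And>i. (f (Suc i), f i) \<in> \<sigma> - Id"
    unfolding wf_iff_no_infinite_down_chain by blast
  have tr': "trans (\<sigma> - Id)"
    using tr an by (rule trans_diff_Id)
  have desc: "(f j, f i) \<in> \<sigma> - Id" if "i < j" for i j
    using that
  proof (induction rule: less_Suc_induct)
    case (2 i j k)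
    then show ?case using tr' by (meson transD)
  qed (rule f)
  text \<open>Dickson's lemma: extract a subsequence that is weakly increasing in every coordinate.\<close>
  have subseq: "\<exists>h::nat \<Rightarrow> nat. strict_mono h \<and>
      (\<forall>x\<in>A. mono (\<lambda>i. Poly_Mapping.lookup (f (h i)) x))" for A :: "'n set"
  proof (induction A rule: infinite_finite_induct)
    case empty
    show ?case by (auto intro: strict_mono_id[unfolded id_def])
  next
    case (insert x A)
    then obtain h :: "nat \<Rightarrow> nat" where h: "strict_mono h" "\<forall>x\<in>A. mono (\<lambda>i. Poly_Mapping.lookup (f (h i)) x)"
      by blast
    define s where "s i = Poly_Mapping.lookup (f (h i)) x" for i
    have "\<exists>k :: nat \<Rightarrow> nat. strict_mono k \<and> mono (\<lambda>i. s (k i))"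
    proof -
      obtain k where k: "strict_mono k" "monoseq (\<lambda>i. s (k i))"
        using seq_monosub[of s] by blast
      show ?thesis
      proof (cases "incseq (\<lambda>i. s (k i))")
        case False
        then have dec: "decseq (\<lambda>i. s (k i))"
          using k(2) by (simp add: monoseq_iff)
        \<comment> \<open>A decreasing sequence of naturals is constant from any index where it
          attains its minimum; dropping the terms before that index leaves a weakly increasing
          one.\<close>
        obtain N where N: "\<And>i. s (k N) \<le> s (k i)"
          using ex_has_least_nat[of "\<lambda>_. True" _ "\<lambda>i. s (k i)"] by blast
        have "s (k (i + N)) = s (k N)" for i
          using N[of "i + N"] decseqD[OF dec, of N "i + N"] by simp
        then have "mono (\<lambda>i. s (k (i + N)))"
          by (simp add: mono_def)
        moreover have "strict_mono (\<lambda>i. k (i + N))"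
          using k(1) by (simp add: strict_mono_def)
        ultimately show ?thesis
          by (intro exI[of _ "\<lambda>i. k (i + N)"]) simp
      qed (use k in blast)
    qed
    then obtain k :: "nat \<Rightarrow> nat" where k: "strict_mono k" "mono (\<lambda>i. s (k i))"
      by blast
    have "mono (\<lambda>i. Poly_Mapping.lookup (f (h (k i))) y)" if "y \<in> insert x A" for y
      using that h(2) k strict_mono_mono[OF k(1)] by (auto simp: s_def mono_def)
    moreover have "strict_mono (\<lambda>i. h (k i))"
      using h(1) k(1) by (simp add: strict_mono_def)
    ultimately show ?case
      by (intro exI[of _ "\<lambda>i. h (k i)"]) simp
  qed simp
  obtain h where h: "strict_mono (h :: nat \<Rightarrow> nat)"
      "\<And>x. mono (\<lambda>i. Poly_Mapping.lookup (f (h i)) x)"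
    using subseq[of UNIV] by auto
  \<comment> \<open>Subtraction of exponents is truncated; monotonicity in every coordinate makes it
    exact here.\<close>
  have "f (h 1) = (f (h 1) - f (h 0)) + f (h 0)"
    by (rule poly_mapping_eqI) (use h(2) in \<open>simp add: lookup_add lookup_minus mono_def\<close>)
  then have "(f (h 0), f (h 1)) \<in> \<sigma>"
    using comp[OF zero, of "f (h 0)" "f (h 1) - f (h 0)"] by simp
  moreover have "(f (h 1), f (h 0)) \<in> \<sigma> - Id"
    using desc[of "h 0" "h 1"] h(1) by (simp add: strict_mono_def)
  ultimately show False
    using an by (auto dest: antisymD)
qed

section \<open>Dimension of the quotient\<close>

lemma ideal_subspace_pscale: "ideal.subspace I \<Longrightarrow> f \<in> I \<Longrightarrow> pscale c f \<in> I"
  unfolding pscale_def by (rule ideal.subspace_scale)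

text \<open>Replacing each \<open>v j\<close> by its representative \<open>w j\<close> in the span
  of B preserves independence modulo I, and a relation among the \<open>w j\<close> in R is in
  particular one modulo I. The exchange lemma in R then gives the bound, with no quotient space
  constructed.\<close>

lemma card_le_quotient_basis:
  assumes I: "ideal.subspace I" and B: "quotient_basis I B" and J: "finite J"
    and indep: "\<And>c. (\<Sum>j\<in>J. pscale (c j) (v j)) \<in> I \<Longrightarrow> \<forall>j\<in>J. c j = 0"
  shows "card J \<le> card B"
proof -
  have "\<forall>f. \<exists>c. f - (\<Sum>b\<in>B. pscale (c b) b) \<in> I"
    using B by (simp add: quotient_basis_def)
  then obtain m where m: "\<And>f. f - (\<Sum>b\<in>B. pscale (m f b) b) \<in> I"
    by metis
  define w where "w j = (\<Sum>b\<in>B. pscale (m (v j) b) b)" for j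
  have w_indep: "\<forall>j\<in>J. c j = 0" if "(\<Sum>j\<in>J. pscale (c j) (w j)) = 0" for c
  proof (rule indep)
    have "(\<Sum>j\<in>J. pscale (c j) (v j - w j)) \<in> I"
      using m I by (auto simp: w_def intro!: ideal.subspace_sum ideal_subspace_pscale)
    then show "(\<Sum>j\<in>J. pscale (c j) (v j)) \<in> I"
      using that by (simp add: poly.scale_right_diff_distrib sum_subtractf)
  qed
  have inj: "inj_on w J"
  proof (rule inj_onI, rule ccontr)
    fix i j assume ij: "i \<in> J" "j \<in> J" "w i = w j" "i \<noteq> j"
    \<comment> \<open>These are the coefficients of the nontrivial relation w i - w j = 0.\<close>
    define c where "c k = (if k = i then 1 else 0) + (if k = j then - 1 else (0::complex))" for k
    have "(\<Sum>k\<in>J. pscale (c k) (w k)) =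
        (\<Sum>k\<in>J. if k = i then w k else 0) + (\<Sum>k\<in>J. if k = j then - w k else 0)"
      unfolding sum.distrib[symmetric] by (rule sum.cong) (auto simp: c_def)
    also have "\<dots> = 0"
      using ij J by simp
    finally have "c i = 0"
      using w_indep ij(1) by blast
    then show False
      using ij(4) by (simp add: c_def)
  qed
  have "poly.independent (w ` J)"
  proof
    assume "poly.dependent (w ` J)"
    then obtain u where u: "\<exists>j\<in>J. u (w j) \<noteq> 0" "(\<Sum>j\<in>J. pscale (u (w j)) (w j)) = 0"
      using J inj by (auto simp: poly.dependent_finite sum.reindex)
    then show False
      using w_indep[of "\<lambda>j. u (w j)"] by blast
  qed
  moreover have "w ` J \<subseteq> poly.span B"
    unfolding w_def by (intro image_subsetI poly.span_sum poly.span_scale poly.span_base)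
  ultimately have "card (w ` J) \<le> card B"
    using B by (auto simp: quotient_basis_def dest: poly.independent_span_bound)
  then show ?thesis
    by (simp add: card_image inj)
qed

lemma quotient_dim_eq_card:
  assumes I: "ideal.subspace I" and B: "quotient_basis I B"
  shows "quotient_dim I = card B"
proof -
  have "card C \<le> card C'" if "quotient_basis I C" "quotient_basis I C'" for C C'
    using card_le_quotient_basis[OF I that(2), of C "\<lambda>b. b"] that(1)
    by (simp add: quotient_basis_def)
  then show ?thesis
    unfolding quotient_dim_def using B by (intro the_equality) (auto intro: antisym)
qed

section \<open>Monomials of high degree lie in the ideal\<close>

lemma total_deg_Suc_decomp:
  assumes "total_deg t = Suc d"
  obtains s x where "t = s + Poly_Mapping.single x 1" "total_deg s = d"
proof -
  have "\<exists>x. Poly_Mapping.lookup t x \<noteq> 0"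
  proof (rule ccontr)
    assume "\<nexists>x. Poly_Mapping.lookup t x \<noteq> 0"
    then show False
      using assms by (simp add: total_deg_def)
  qed
  then obtain x where x: "Poly_Mapping.lookup t x \<noteq> 0"
    by blast
  define s where "s = t - Poly_Mapping.single x 1"
  have t: "t = s + Poly_Mapping.single x 1"
    by (rule poly_mapping_eqI) (use x in \<open>auto simp: s_def lookup_add lookup_minus lookup_single when_def\<close>)
  have "total_deg t = total_deg s + 1"
    by (simp add: t total_deg_def lookup_add sum.distrib lookup_single when_def)
  with assms t show thesis
    by (intro that[of s x]) auto
qed

text \<open>Stripping one variable at a time from t yields \<open>total_deg t + 1\<close> monomials.
  Strictness, recorded as \<open>u \<noteq> 0\<close>, later ensures that only the lowest term of a
  relation contributes a constant term to the cofactor.\<close>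

lemma divisor_chain:
  "\<exists>s. s (total_deg t) = t \<and>
    (\<forall>i j. i < j \<longrightarrow> j \<le> total_deg t \<longrightarrow> (\<exists>u. u \<noteq> 0 \<and> s j = s i + u))"
proof (induction "total_deg t" arbitrary: t)
  case 0
  then show ?case
    by (intro exI[of _ "\<lambda>_. t"]) simp
next
  case (Suc d)
  obtain t' x where t': "t = t' + Poly_Mapping.single x 1" "total_deg t' = d"
    using Suc.hyps(2)[symmetric] by (rule total_deg_Suc_decomp)
  obtain s where s: "s d = t'" "\<And>i j. i < j \<Longrightarrow> j \<le> d \<Longrightarrow> \<exists>u. u \<noteq> 0 \<and> s j = s i + u"
    using Suc.hyps(1)[of t'] t'(2) by auto
  have step: "\<exists>u. u \<noteq> 0 \<and> t = s i + u" if "i \<le> d" for i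
  proof -
    have "\<exists>u. t' = s i + u"
      using s(1) s(2)[of i d] that by (cases "i = d") auto
    then obtain u where "t' = s i + u" ..
    then have "t = s i + (u + Poly_Mapping.single x 1)"
      by (simp add: t'(1) add.assoc)
    moreover have "u + Poly_Mapping.single x 1 \<noteq> 0"
      unfolding pp_add_eq_0_iff by (metis lookup_single_eq lookup_zero zero_neq_one)
    ultimately show ?thesis
      by blast
  qed
  show ?case
    unfolding Suc.hyps(2)[symmetric]
    by (rule exI[of _ "s(Suc d := t)"]) (use s(2) step in \<open>auto simp: le_Suc_eq\<close>)
qed

lemma high_degree_monomial_in_ideal:
  assumes I: "primary_ideal I" and "(\<lambda>_. 0) \<in> zero_set I" and B: "quotient_basis I B"
    and deg: "card B \<le> total_deg t"
  shows "Poly_Mapping.single t 1 \<in> I"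
proof (rule ccontr)
  assume t: "Poly_Mapping.single t 1 \<notin> I"
  have sub: "ideal.subspace I" and primary: "\<And>f g. f * g \<in> I \<Longrightarrow> f \<in> I \<or> (\<exists>k. g ^ k \<in> I)"
    using I by (auto simp: primary_ideal_def)
  have vanish: "Poly_Mapping.lookup f 0 = 0" if "f \<in> I" for f
    using assms(2) that by (auto simp: zero_set_def eval_0)
  define d where "d = total_deg t"
  obtain s where s: "s d = t" "\<And>i j. i < j \<Longrightarrow> j \<le> d \<Longrightarrow> \<exists>u. u \<noteq> 0 \<and> s j = s i + u"
    using divisor_chain[of t] by (auto simp: d_def)
  have s_notin: "Poly_Mapping.single (s i) 1 \<notin> I" if "i \<le> d" for i
  proof
    assume si: "Poly_Mapping.single (s i) 1 \<in> I"
    have "\<exists>u. t = s i + u"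
      using s(1) s(2)[of i d] that by (cases "i = d") auto
    then obtain u where "t = s i + u" ..
    then show False
      using t ideal.subspace_scale[OF sub si, of "Poly_Mapping.single u 1"]
      by (simp add: mult_single add.commute)
  qed
  \<comment> \<open>The chain has d + 1 members, one too many since
    \<open>card B \<le> d\<close>.\<close>
  have "card {..d} \<le> card B"
  proof (rule card_le_quotient_basis[OF sub B])
    fix c assume c: "(\<Sum>j\<le>d. pscale (c j) (Poly_Mapping.single (s j) 1)) \<in> I"
    show "\<forall>j\<in>{..d}. c j = 0"
    proof (rule ccontr)
      assume "\<not> (\<forall>j\<in>{..d}. c j = 0)"
      then have ex: "\<exists>j. j \<le> d \<and> c j \<noteq> 0"
        by auto
      \<comment> \<open>With the least index, every other monomial in the relation is a proper
        multiple of \<open>s i\<close>, so \<open>s i\<close> can be factored out.\<close>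
      define i where "i = (LEAST j. j \<le> d \<and> c j \<noteq> 0)"
      have i: "i \<le> d" "c i \<noteq> 0"
        using LeastI_ex[OF ex] by (auto simp: i_def)
      have below: "c j = 0" if "j < i" for j
        using not_less_Least[of j "\<lambda>j. j \<le> d \<and> c j \<noteq> 0"] that i(1) by (auto simp: i_def[symmetric])
      have "\<forall>j\<in>{i<..d}. \<exists>u. u \<noteq> 0 \<and> s j = s i + u"
        using s(2) by auto
      then obtain u where u: "\<And>j. j \<in> {i<..d} \<Longrightarrow> u j \<noteq> 0 \<and> s j = s i + u j"
        by metis
      text \<open>Dividing the relation by its lowest term leaves a cofactor with nonzero constant
        term, none of whose powers can lie in \<open>I\<close>.\<close>
      define g where "g = Poly_Mapping.single 0 (c i) + (\<Sum>j\<in>{i<..d}. Poly_Mapping.single (u j) (c j))"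
      have "Poly_Mapping.lookup (\<Sum>j\<in>{i<..d}. Poly_Mapping.single (u j) (c j)) 0 = 0"
        using u by (simp add: lookup_sum lookup_single when_def)
      then have g0: "Poly_Mapping.lookup g 0 = c i"
        by (simp add: g_def lookup_add)
      have "(\<Sum>j\<le>d. pscale (c j) (Poly_Mapping.single (s j) 1)) =
          (\<Sum>j\<in>{i..d}. Poly_Mapping.single (s j) (c j))"
        by (rule sum.mono_neutral_cong_right) (auto simp: pscale_eq_single_mult below)
      also have "\<dots> = Poly_Mapping.single (s i) (c i) + (\<Sum>j\<in>{i<..d}. Poly_Mapping.single (s j) (c j))"
        using i(1) by (simp add: sum.head)
      also have "(\<Sum>j\<in>{i<..d}. Poly_Mapping.single (s j) (c j)) =
          (\<Sum>j\<in>{i<..d}. Poly_Mapping.single (s i) 1 * Poly_Mapping.single (u j) (c j))"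
        by (rule sum.cong) (use u in \<open>auto simp: mult_single\<close>)
      also have "Poly_Mapping.single (s i) (c i) + \<dots> = Poly_Mapping.single (s i) 1 * g"
        by (simp add: g_def distrib_left sum_distrib_left mult_single)
      finally have "Poly_Mapping.single (s i) 1 * g \<in> I"
        using c by simp
      \<comment> \<open>The case k = 0 is covered as well: the constant term of 1 is
        nonzero.\<close>
      then obtain k where "g ^ k \<in> I"
        using primary s_notin[OF i(1)] by blast
      then show False
        using vanish[of "g ^ k"] g0 i(2) by (simp add: lookup_power_0)
    qed
  qed simp
  then show False
    using deg by (simp add: d_def)
qed

section \<open>Taylor truncation\<close>

lemma finite_total_deg_less: "finite {\<alpha> :: 'n::finite pp. total_deg \<alpha> < m}"
proof -
  have "Poly_Mapping.lookup \<alpha> x < m" if "total_deg \<alpha> < m" for \<alpha> :: "'n pp" and x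
    using that member_le_sum[of x UNIV "Poly_Mapping.lookup \<alpha>"] by (simp add: total_deg_def)
  then have "Poly_Mapping.lookup ` {\<alpha> :: 'n pp. total_deg \<alpha> < m} \<subseteq>
      {f. \<forall>x. (x \<in> UNIV \<longrightarrow> f x \<in> {..<m}) \<and> (x \<notin> UNIV \<longrightarrow> f x = 0)}"
    by auto
  then have "finite (Poly_Mapping.lookup ` {\<alpha> :: 'n pp. total_deg \<alpha> < m})"
    by (rule finite_subset) (intro finite_set_of_finite_funs finite finite_lessThan)
  then show ?thesis
    by (rule finite_imageD) (auto intro!: inj_onI poly_mapping_eqI)
qed

lemma lookup_generic_taylor:
  "Poly_Mapping.lookup (generic_taylor m c) t = (if total_deg t < m then c t else 0)"
  by (simp add: finite_total_deg_less generic_taylor_def lookup_sum lookup_single when_def)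

lemma diff_generic_taylor_in_ideal:
  assumes I: "ideal.subspace I"
    and high: "\<And>t. m \<le> total_deg t \<Longrightarrow> Poly_Mapping.single t 1 \<in> I"
  shows "f - generic_taylor m (Poly_Mapping.lookup f) \<in> I"
proof -
  have "f - generic_taylor m (Poly_Mapping.lookup f) =
      (\<Sum>t\<in>{t\<in>Poly_Mapping.keys f. m \<le> total_deg t}.
        pscale (Poly_Mapping.lookup f t) (Poly_Mapping.single t 1))"
    by (rule poly_mapping_eqI)
       (auto simp: pscale_eq_single_mult lookup_minus lookup_generic_taylor lookup_sum
          lookup_single when_def in_keys_iff)
  also have "\<dots> \<in> I"
    using I high by (auto intro!: ideal.subspace_sum ideal_subspace_pscale)
  finally show ?thesis .
qed

section \<open>Groebner bases, division and normal forms\<close>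

definition standard :: "'n pp rel \<Rightarrow> 'n mpoly set \<Rightarrow> 'n pp set" where
  "standard \<sigma> G = {t. \<forall>g\<in>G. \<nexists>u. t = lead_pp \<sigma> g + u}"

text \<open>Membership in a monomial ideal is visible on exponents: the polynomials whose exponents
  are all multiples of leading power products form an ideal W containing the generators.\<close>

lemma monomial_in_lead_ideal:
  fixes F :: "'a mpoly set"
  assumes "Poly_Mapping.single t 1 \<in> lead_ideal \<sigma> F"
  shows "\<exists>f\<in>F. f \<noteq> 0 \<and> (\<exists>u. t = lead_pp \<sigma> f + u)"
proof -
  define W :: "'a mpoly set" where "W = {h. \<forall>s\<in>Poly_Mapping.keys h. \<exists>f\<in>F. f \<noteq> 0 \<and> (\<exists>u. s = lead_pp \<sigma> f + u)}"
  have "ideal.subspace W"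
  proof (rule ideal.subspaceI)
    fix h k assume "h \<in> W" "k \<in> W"
    then show "h + k \<in> W"
      using keys_add[of h k] unfolding W_def by blast
  next
    fix c h assume h: "h \<in> W"
    show "c * h \<in> W"
      unfolding W_def
    proof (rule CollectI, rule ballI)
      fix s assume "s \<in> Poly_Mapping.keys (c * h)"
      then obtain a b where s: "s = a + b" "b \<in> Poly_Mapping.keys h"
        using keys_mult[of c h] by blast
      then obtain f u where "f \<in> F" "f \<noteq> 0" "b = lead_pp \<sigma> f + u"
        using h unfolding W_def by blast
      then show "\<exists>f\<in>F. f \<noteq> 0 \<and> (\<exists>u. s = lead_pp \<sigma> f + u)"
        using s(1) by (metis add.left_commute)
    qed
  qed (simp add: W_def)
  moreover have "{Poly_Mapping.single (lead_pp \<sigma> f) 1 | f. f \<in> F \<and> f \<noteq> 0} \<subseteq> W"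
    by (auto simp: W_def)
  ultimately have "lead_ideal \<sigma> F \<subseteq> W"
    unfolding lead_ideal_def by (intro ideal.span_minimal)
  then have "Poly_Mapping.single t 1 \<in> W"
    using assms by blast
  then show ?thesis
    by (simp add: W_def)
qed

context
  fixes \<sigma> :: "'n::finite pp rel"
  assumes ordering: "term_ordering \<sigma>"
begin

lemma ordering_refl: "(t, t) \<in> \<sigma>"
  and ordering_trans: "(s, t) \<in> \<sigma> \<Longrightarrow> (t, u) \<in> \<sigma> \<Longrightarrow> (s, u) \<in> \<sigma>"
  and ordering_antisym: "(s, t) \<in> \<sigma> \<Longrightarrow> (t, s) \<in> \<sigma> \<Longrightarrow> s = t"
  and ordering_linear: "(s, t) \<in> \<sigma> \<or> (t, s) \<in> \<sigma>"
  and ordering_add: "(s, t) \<in> \<sigma> \<Longrightarrow> (u + s, u + t) \<in> \<sigma>"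
proof -
  have lin: "linear_order \<sigma>" and add: "\<And>s t u. (s, t) \<in> \<sigma> \<Longrightarrow> (s + u, t + u) \<in> \<sigma>"
    using ordering by (auto simp: term_ordering_def)
  then have "refl \<sigma>" "trans \<sigma>" "antisym \<sigma>" "total \<sigma>"
    by (auto simp: order_on_defs)
  then show "(t, t) \<in> \<sigma>" "(s, t) \<in> \<sigma> \<Longrightarrow> (t, u) \<in> \<sigma> \<Longrightarrow> (s, u) \<in> \<sigma>"
      "(s, t) \<in> \<sigma> \<Longrightarrow> (t, s) \<in> \<sigma> \<Longrightarrow> s = t" "(s, t) \<in> \<sigma> \<or> (t, s) \<in> \<sigma>"
    by (auto simp: total_on_def dest: refl_onD transD antisymD) (metis UNIV_I refl_onD)
  show "(s, t) \<in> \<sigma> \<Longrightarrow> (u + s, u + t) \<in> \<sigma>"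
    using add[of s t u] by (simp add: add.commute)
qed

lemma lead_pp_eqI:
  assumes "t \<in> Poly_Mapping.keys f" "\<And>s. s \<in> Poly_Mapping.keys f \<Longrightarrow> (s, t) \<in> \<sigma>"
  shows "lead_pp \<sigma> f = t"
  unfolding lead_pp_def using assms ordering_antisym by (intro the_equality) auto

lemma lead_pp_max:
  assumes "f \<noteq> 0"
  shows "lead_pp \<sigma> f \<in> Poly_Mapping.keys f"
    and "s \<in> Poly_Mapping.keys f \<Longrightarrow> (s, lead_pp \<sigma> f) \<in> \<sigma>"
proof -
  have max: "\<exists>t\<in>A. \<forall>s\<in>A. (s, t) \<in> \<sigma>" if "finite A" "A \<noteq> {}" for A
    using that
  proof (induction A rule: finite_ne_induct)
    case (insert x A)
    then show ?case
      using ordering_linear ordering_trans ordering_refl by (metis insert_iff)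
  qed (simp add: ordering_refl)
  have "Poly_Mapping.keys f \<noteq> {}"
    using assms by (auto simp: poly_mapping_eq_iff fun_eq_iff in_keys_iff)
  from max[OF finite_keys this] obtain t where t: "t \<in> Poly_Mapping.keys f" "\<And>s. s \<in> Poly_Mapping.keys f \<Longrightarrow> (s, t) \<in> \<sigma>"
    by blast
  then have "lead_pp \<sigma> f = t"
    by (rule lead_pp_eqI)
  then show "lead_pp \<sigma> f \<in> Poly_Mapping.keys f"
    and "s \<in> Poly_Mapping.keys f \<Longrightarrow> (s, lead_pp \<sigma> f) \<in> \<sigma>"
    using t by auto
qed

lemma lead_pp_multiple_of_groebner:
  assumes "groebner_basis \<sigma> I G" "f \<in> I" "f \<noteq> 0"
  shows "\<exists>g\<in>G. \<exists>u. lead_pp \<sigma> f = lead_pp \<sigma> g + u"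
proof -
  have "Poly_Mapping.single (lead_pp \<sigma> f) 1 \<in> lead_ideal \<sigma> I"
    unfolding lead_ideal_def using assms by (intro ideal.span_base) auto
  then have "Poly_Mapping.single (lead_pp \<sigma> f) 1 \<in> lead_ideal \<sigma> G"
    using assms by (simp add: groebner_basis_def)
  then show ?thesis
    using monomial_in_lead_ideal by blast
qed

text \<open>The leading power product of a nonzero element of I is a multiple of one from G, hence
  not standard. Uniqueness of normal forms and the degree bound on standard monomials both rest on
  this.\<close>

lemma standard_in_ideal_eq_0:
  assumes "groebner_basis \<sigma> I G" "f \<in> I" "Poly_Mapping.keys f \<subseteq> standard \<sigma> G"
  shows "f = 0"
proof (rule ccontr)
  assume "f \<noteq> 0"
  then show False
    using lead_pp_multiple_of_groebner[OF assms(1,2)] lead_pp_max(1) assms(3)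
    by (fastforce simp: standard_def)
qed

text \<open>The induction is on an upper bound t for the exponents. Each step removes the term at t,
  and the bound on the summands \<open>q g * g\<close> is inherited from the smaller instance,
  giving the degree condition that \<open>division_remainder\<close> imposes.\<close>

lemma bounded_division:
  assumes G: "finite G" "0 \<notin> G"
    and "\<And>s. s \<in> Poly_Mapping.keys f \<Longrightarrow> (s, t) \<in> \<sigma>"
  shows "\<exists>q r. f = (\<Sum>g\<in>G. q g * g) + r \<and>
    (\<forall>g\<in>G. \<forall>s\<in>Poly_Mapping.keys (q g * g). (s, t) \<in> \<sigma>) \<and>
    Poly_Mapping.keys r \<subseteq> standard \<sigma> G"
  using assms(3)
proof (induction t arbitrary: f rule: wf_induct_rule[OF term_ordering_wf[OF ordering]])
  case (1 t)
  \<comment> \<open>Once t no longer occurs, the leading power product of h is strictly below t and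
    serves as the new bound.\<close>
  have below: "\<exists>q r. h = (\<Sum>g\<in>G. q g * g) + r \<and>
      (\<forall>g\<in>G. \<forall>s\<in>Poly_Mapping.keys (q g * g). (s, t) \<in> \<sigma>) \<and>
      Poly_Mapping.keys r \<subseteq> standard \<sigma> G"
    if h: "\<And>s. s \<in> Poly_Mapping.keys h \<Longrightarrow> (s, t) \<in> \<sigma>" "t \<notin> Poly_Mapping.keys h" for h
  proof (cases "h = 0")
    case True
    then show ?thesis
      by (intro exI[of _ "\<lambda>_. 0"] exI[of _ 0]) simp
  next
    case False
    have "(lead_pp \<sigma> h, t) \<in> \<sigma> - Id"
      using lead_pp_max(1)[OF False] h by auto
    then obtain q r where "h = (\<Sum>g\<in>G. q g * g) + r"
        "\<And>g s. g \<in> G \<Longrightarrow> s \<in> Poly_Mapping.keys (q g * g) \<Longrightarrow> (s, lead_pp \<sigma> h) \<in> \<sigma>"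
        "Poly_Mapping.keys r \<subseteq> standard \<sigma> G"
      using 1(1)[of "lead_pp \<sigma> h" h] lead_pp_max(2)[OF False] by blast
    then show ?thesis
      using \<open>(lead_pp \<sigma> h, t) \<in> \<sigma> - Id\<close> ordering_trans by blast
  qed
  define c where "c = Poly_Mapping.lookup f t"
  show ?case
  proof (cases "t \<in> standard \<sigma> G")
    case True
    define h where "h = f - Poly_Mapping.single t c"
    have "Poly_Mapping.keys h \<subseteq> Poly_Mapping.keys f - {t}"
      by (auto simp: h_def in_keys_iff lookup_minus lookup_single c_def when_def split: if_splits)
    then obtain q r where qr: "h = (\<Sum>g\<in>G. q g * g) + r"
        "\<forall>g\<in>G. \<forall>s\<in>Poly_Mapping.keys (q g * g). (s, t) \<in> \<sigma>" "Poly_Mapping.keys r \<subseteq> standard \<sigma> G"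
      using below[of h] 1(2) by blast
    have "f = (\<Sum>g\<in>G. q g * g) + (r + Poly_Mapping.single t c)"
      using qr(1) by (simp add: h_def algebra_simps)
    moreover have "Poly_Mapping.keys (r + Poly_Mapping.single t c) \<subseteq> standard \<sigma> G"
      using keys_add[of r "Poly_Mapping.single t c"] qr(3) True by (auto split: if_splits)
    ultimately show ?thesis
      using qr(2) by blast
  next
    case False
    then obtain g u where g: "g \<in> G" "t = lead_pp \<sigma> g + u"
      by (auto simp: standard_def)
    have "g \<noteq> 0"
      using g G by auto
    define lc where "lc = Poly_Mapping.lookup g (lead_pp \<sigma> g)"
    have "lc \<noteq> 0"
      using lead_pp_max(1)[OF \<open>g \<noteq> 0\<close>] by (simp add: lc_def in_keys_iff)
    \<comment> \<open>The factor c / lc makes the coefficient of \<open>m * g\<close> at t equal to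
      c, so that subtraction cancels the term of f there.\<close>
    define m where "m = Poly_Mapping.single u (c / lc)"
    have keys_mg: "(s, t) \<in> \<sigma>" if "s \<in> Poly_Mapping.keys (m * g)" for s
      using that keys_single_mult_subset[of u "c / lc" g] lead_pp_max(2)[OF \<open>g \<noteq> 0\<close>]
        ordering_add[of _ "lead_pp \<sigma> g" u]
      by (auto simp: m_def g(2) add.commute)
    have "Poly_Mapping.lookup (m * g) t = c"
      using lookup_single_mult_add[of u "c / lc" g "lead_pp \<sigma> g"] \<open>lc \<noteq> 0\<close>
      by (simp add: m_def g(2) add.commute lc_def)
    then have t_notin: "t \<notin> Poly_Mapping.keys (f - m * g)"
      by (simp add: in_keys_iff lookup_minus c_def)
    have "Poly_Mapping.keys (f - m * g) \<subseteq> Poly_Mapping.keys f \<union> Poly_Mapping.keys (m * g)"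
      by (auto simp: in_keys_iff lookup_minus)
    then have "(s, t) \<in> \<sigma>" if "s \<in> Poly_Mapping.keys (f - m * g)" for s
      using that 1(2) keys_mg by blast
    then obtain q r where qr: "f - m * g = (\<Sum>h\<in>G. q h * h) + r"
        "\<And>h s. h \<in> G \<Longrightarrow> s \<in> Poly_Mapping.keys (q h * h) \<Longrightarrow> (s, t) \<in> \<sigma>"
        "Poly_Mapping.keys r \<subseteq> standard \<sigma> G"
      using below[of "f - m * g"] t_notin by blast
    define q' where "q' = q(g := q g + m)"
    have "(\<Sum>h\<in>G. q' h * h) = (\<Sum>h\<in>G. q h * h + (if h = g then m * g else 0))"
      by (rule sum.cong) (auto simp: q'_def distrib_right)
    also have "\<dots> = (\<Sum>h\<in>G. q h * h) + m * g"
      using G g(1) by (simp add: sum.distrib)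
    finally have "f = (\<Sum>h\<in>G. q' h * h) + r"
      using qr(1) by (simp add: algebra_simps)
    moreover have "(s, t) \<in> \<sigma>" if "h \<in> G" "s \<in> Poly_Mapping.keys (q' h * h)" for h s
    proof (cases "h = g")
      case True
      then have "s \<in> Poly_Mapping.keys (q g * g) \<union> Poly_Mapping.keys (m * g)"
        using that(2) keys_add[of "q g * g" "m * g"] by (auto simp: q'_def distrib_right)
      then show ?thesis
        using qr(2)[OF g(1)] keys_mg by blast
    qed (use that qr(2) in \<open>simp add: q'_def\<close>)
    ultimately show ?thesis
      using qr(3) by blast
  qed
qed

lemma division_remainder_exists:
  assumes "finite G" "0 \<notin> G"
  shows "\<exists>r. division_remainder \<sigma> G f r"
proof (cases "f = 0")
  \<comment> \<open>\<open>lead_pp\<close> has no meaning at 0, and for f = 0 the definition asks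
    every summand to vanish; zero quotients satisfy it.\<close>
  case True
  then show ?thesis
    by (auto simp: division_remainder_def intro!: exI[of _ "0 :: 'n mpoly"] exI[of _ "\<lambda>_. 0"])
next
  case False
  obtain q r where "f = (\<Sum>g\<in>G. q g * g) + r"
      "\<And>g s. g \<in> G \<Longrightarrow> s \<in> Poly_Mapping.keys (q g * g) \<Longrightarrow> (s, lead_pp \<sigma> f) \<in> \<sigma>"
      "Poly_Mapping.keys r \<subseteq> standard \<sigma> G"
    using bounded_division[OF assms lead_pp_max(2)[OF False]] by blast
  then have "division_remainder \<sigma> G f r"
    using False lead_pp_max(1) unfolding division_remainder_def standard_def by blast
  then show ?thesis ..
qed

lemma keys_division_remainder:
  "division_remainder \<sigma> G f r \<Longrightarrow> Poly_Mapping.keys r \<subseteq> standard \<sigma> G"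
  by (auto simp: division_remainder_def standard_def)

lemma diff_division_remainder:
  assumes I: "ideal.subspace I" and "G \<subseteq> I" and r: "division_remainder \<sigma> G f r"
  shows "f - r \<in> I"
proof -
  obtain q where "f = (\<Sum>g\<in>G. q g * g) + r"
    using r unfolding division_remainder_def by blast
  moreover have "(\<Sum>g\<in>G. q g * g) \<in> I"
    using I \<open>G \<subseteq> I\<close> by (intro ideal.subspace_sum ideal.subspace_scale) auto
  ultimately show "f - r \<in> I"
    by simp
qed

lemma standard_representative_unique:
  assumes I: "ideal.subspace I" and G: "groebner_basis \<sigma> I G"
    and "f - r \<in> I" "Poly_Mapping.keys r \<subseteq> standard \<sigma> G"
    and "f - r' \<in> I" "Poly_Mapping.keys r' \<subseteq> standard \<sigma> G"
  shows "r = r'"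
proof -
  have "(f - r') - (f - r) \<in> I"
    using I assms(5,3) by (rule ideal.subspace_diff)
  moreover have "Poly_Mapping.keys (r - r') \<subseteq> Poly_Mapping.keys r \<union> Poly_Mapping.keys r'"
    by (auto simp: in_keys_iff lookup_minus)
  ultimately have "r - r' = 0"
    using assms(4,6) by (intro standard_in_ideal_eq_0[OF G]) auto
  then show ?thesis
    by simp
qed

lemma
  assumes I: "ideal.subspace I" and G: "groebner_basis \<sigma> I G"
  shows diff_normal_form: "f - normal_form \<sigma> G f \<in> I"
    and keys_normal_form: "Poly_Mapping.keys (normal_form \<sigma> G f) \<subseteq> standard \<sigma> G"
proof -
  have "G \<subseteq> I" "finite G" "0 \<notin> G"
    using G by (auto simp: groebner_basis_def)
  note * = diff_division_remainder[OF I \<open>G \<subseteq> I\<close>] keys_division_remainder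
  have "\<exists>!r. division_remainder \<sigma> G f r"
    using division_remainder_exists[OF \<open>finite G\<close> \<open>0 \<notin> G\<close>, of f]
      standard_representative_unique[OF I G] * by metis
  then have "division_remainder \<sigma> G f (normal_form \<sigma> G f)"
    unfolding normal_form_def by (rule theI')
  then show "f - normal_form \<sigma> G f \<in> I"
    and "Poly_Mapping.keys (normal_form \<sigma> G f) \<subseteq> standard \<sigma> G"
    by (rule *)+
qed

text \<open>Frees later arguments from division: to compute a normal form it suffices to exhibit an
  element of the same class supported on standard monomials.\<close>

lemma normal_form_eqI:
  assumes "ideal.subspace I" "groebner_basis \<sigma> I G"
    and "f - r \<in> I" "Poly_Mapping.keys r \<subseteq> standard \<sigma> G"
  shows "normal_form \<sigma> G f = r"
  using standard_representative_unique[OF assms(1,2)] assms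
    diff_normal_form[OF assms(1,2)] keys_normal_form[OF assms(1,2)] by blast

end

section \<open>Standard monomials and the linear forms of the procedure\<close>

lemma generic_taylor_unit:
  "total_deg \<alpha> < m \<Longrightarrow> generic_taylor m (\<lambda>t. if t = \<alpha> then 1 else 0) = Poly_Mapping.single \<alpha> 1"
  by (rule poly_mapping_eqI) (auto simp: lookup_generic_taylor lookup_single when_def)

lemma output_op_in_diff_ops: "output_op m a \<beta> \<in> diff_ops"
  unfolding output_op_def diff_ops_def
  by (intro oper.span_sum oper.span_scale oper.span_base) auto

context
  fixes \<sigma> :: "'n::finite pp rel" and I G :: "'n mpoly set" and \<mu> :: nat
  assumes ordering: "term_ordering \<sigma>"
    and primary: "primary_ideal I"
    and zero_dim: "zero_dimensional I"
    and zero: "(\<lambda>_. 0) \<in> zero_set I"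
    and groebner: "groebner_basis \<sigma> I G"
  defines "\<mu> \<equiv> quotient_dim I"
begin

lemma subspace: "ideal.subspace I"
  using primary by (simp add: primary_ideal_def)

lemma high_degree_in_I: "\<mu> \<le> total_deg t \<Longrightarrow> Poly_Mapping.single t 1 \<in> I"
  using zero_dim high_degree_monomial_in_ideal[OF primary zero] quotient_dim_eq_card[OF subspace]
  by (auto simp: zero_dimensional_def \<mu>_def)

lemma lookup_normal_form_nonzero:
  "Poly_Mapping.lookup (normal_form \<sigma> G f) t \<noteq> 0 \<Longrightarrow> t \<in> standard \<sigma> G"
  using keys_normal_form[OF ordering subspace groebner, of f] by (meson in_keys_iff subsetD)

text \<open>Truncation thus loses no standard monomial: each occurs in the generic Taylor
  polynomial, and there are finitely many.\<close>

lemma total_deg_standard_less: "\<beta> \<in> standard \<sigma> G \<Longrightarrow> total_deg \<beta> < \<mu>"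
proof (rule ccontr)
  assume \<beta>: "\<beta> \<in> standard \<sigma> G" and "\<not> total_deg \<beta> < \<mu>"
  then have "Poly_Mapping.single \<beta> 1 \<in> I"
    by (simp add: high_degree_in_I)
  moreover have "Poly_Mapping.keys (Poly_Mapping.single \<beta> (1::complex)) \<subseteq> standard \<sigma> G"
    using \<beta> by simp
  ultimately have "Poly_Mapping.single \<beta> (1::complex) = 0"
    by (rule standard_in_ideal_eq_0[OF ordering groebner])
  then show False
    by (metis lookup_single_eq lookup_zero zero_neq_one)
qed

lemma finite_standard: "finite (standard \<sigma> G)"
  by (rule finite_subset[OF _ finite_total_deg_less[of \<mu>]]) (auto intro: total_deg_standard_less)

lemma card_standard: "card (standard \<sigma> G) = \<mu>"
proof -
  let ?B = "(\<lambda>t. Poly_Mapping.single t 1) ` standard \<sigma> G :: 'n mpoly set"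
  have inj: "inj_on (\<lambda>t. Poly_Mapping.single t (1::complex)) (standard \<sigma> G)"
    by (rule inj_onI) (metis keys_single singleton_inject zero_neq_one)
  have sum_B: "(\<Sum>b\<in>?B. pscale (c b) b) =
      (\<Sum>t\<in>standard \<sigma> G. Poly_Mapping.single t (c (Poly_Mapping.single t 1)))" for c
    by (simp add: sum.reindex[OF inj] pscale_eq_single_mult)
  have "quotient_basis I ?B"
    unfolding quotient_basis_def
  proof (intro conjI allI impI ballI)
    show "finite ?B"
      using finite_standard by simp
  next
    fix f
    let ?r = "normal_form \<sigma> G f"
    \<comment> \<open>\<open>quotient_basis\<close> indexes coefficients by basis elements, so the
      exponent has to be recovered from its monomial.\<close>
    define c where "c b = Poly_Mapping.lookup ?r (THE t. b = Poly_Mapping.single t 1)" for b :: "'n mpoly"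
    have c: "c (Poly_Mapping.single t 1) = Poly_Mapping.lookup ?r t" for t
    proof -
      have "(THE s. Poly_Mapping.single t (1::complex) = Poly_Mapping.single s 1) = t"
        by (rule the_equality) (auto dest!: arg_cong[of _ _ Poly_Mapping.keys])
      then show ?thesis
        by (simp add: c_def)
    qed
    have "(\<Sum>t\<in>standard \<sigma> G. Poly_Mapping.single t (Poly_Mapping.lookup ?r t)) = ?r"
      using keys_normal_form[OF ordering subspace groebner, of f] finite_standard
      by (subst (2) poly_eq_sum_single, intro sum.mono_neutral_right) (auto simp: in_keys_iff)
    then show "\<exists>c. f - (\<Sum>b\<in>?B. pscale (c b) b) \<in> I"
      using diff_normal_form[OF ordering subspace groebner, of f] c
      unfolding sum_B by (intro exI[of _ c]) simp
  next
    fix c b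
    assume "(\<Sum>b\<in>?B. pscale (c b) b) \<in> I" "b \<in> ?B"
    define f where "f = (\<Sum>t\<in>standard \<sigma> G. Poly_Mapping.single t (c (Poly_Mapping.single t 1)))"
    have f: "Poly_Mapping.lookup f t = (if t \<in> standard \<sigma> G then c (Poly_Mapping.single t 1) else 0)" for t
      by (simp add: f_def lookup_sum lookup_single when_def finite_standard)
    have "f = 0"
    proof (rule standard_in_ideal_eq_0[OF ordering groebner])
      show "f \<in> I"
        using \<open>(\<Sum>b\<in>?B. pscale (c b) b) \<in> I\<close> unfolding sum_B f_def .
      show "Poly_Mapping.keys f \<subseteq> standard \<sigma> G"
        by (auto simp: in_keys_iff f split: if_splits)
    qed
    then have "c (Poly_Mapping.single t 1) = 0" if "t \<in> standard \<sigma> G" for t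
      using f[of t] that by simp
    then show "c b = 0"
      using \<open>b \<in> ?B\<close> by auto
  qed
  then show ?thesis
    unfolding \<mu>_def by (simp add: quotient_dim_eq_card[OF subspace] card_image[OF inj])
qed

text \<open>Linearity follows from uniqueness: the right-hand side is congruent to the Taylor
  polynomial modulo I and supported on standard monomials.\<close>

lemma normal_form_generic_taylor:
  "normal_form \<sigma> G (generic_taylor \<mu> c) =
    (\<Sum>\<alpha> | total_deg \<alpha> < \<mu>. pscale (c \<alpha>) (normal_form \<sigma> G (Poly_Mapping.single \<alpha> 1)))"
proof (rule normal_form_eqI[OF ordering subspace groebner])
  let ?NF = "\<lambda>\<alpha>. normal_form \<sigma> G (Poly_Mapping.single \<alpha> 1)"
  have "(\<Sum>\<alpha> | total_deg \<alpha> < \<mu>. pscale (c \<alpha>) (Poly_Mapping.single \<alpha> 1 - ?NF \<alpha>)) \<in> I"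
    by (intro ideal.subspace_sum ideal_subspace_pscale subspace
          diff_normal_form[OF ordering subspace groebner])
  then show "generic_taylor \<mu> c - (\<Sum>\<alpha> | total_deg \<alpha> < \<mu>. pscale (c \<alpha>) (?NF \<alpha>)) \<in> I"
    by (simp add: poly.scale_right_diff_distrib sum_subtractf pscale_eq_single_mult generic_taylor_def)
  show "Poly_Mapping.keys (\<Sum>\<alpha> | total_deg \<alpha> < \<mu>. pscale (c \<alpha>) (?NF \<alpha>)) \<subseteq> standard \<sigma> G"
  proof
    fix t assume t: "t \<in> Poly_Mapping.keys (\<Sum>\<alpha> | total_deg \<alpha> < \<mu>. pscale (c \<alpha>) (?NF \<alpha>))"
    have "\<exists>\<alpha>. Poly_Mapping.lookup (?NF \<alpha>) t \<noteq> 0"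
    proof (rule ccontr)
      assume "\<nexists>\<alpha>. Poly_Mapping.lookup (?NF \<alpha>) t \<noteq> 0"
      then show False
        using t by (simp add: in_keys_iff lookup_sum)
    qed
    then show "t \<in> standard \<sigma> G"
      using lookup_normal_form_nonzero by blast
  qed
qed

text \<open>Identifies a_{\<beta>\<alpha>} as the coefficient of x^\<beta> in the normal form of
  x^\<alpha>, the witness used in the theorem.\<close>

lemma nf_coeff_eq:
  "nf_coeff \<sigma> G \<mu> \<beta> c = (\<Sum>\<alpha> | total_deg \<alpha> < \<mu>.
    Poly_Mapping.lookup (normal_form \<sigma> G (Poly_Mapping.single \<alpha> 1)) \<beta> * c \<alpha>)"
  by (simp add: nf_coeff_def normal_form_generic_taylor lookup_sum mult.commute)

lemma normal_form_standard:
  "\<beta> \<in> standard \<sigma> G \<Longrightarrow> normal_form \<sigma> G (Poly_Mapping.single \<beta> 1) = Poly_Mapping.single \<beta> 1"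
  using ideal.subspace_0[OF subspace]
  by (intro normal_form_eqI[OF ordering subspace groebner]) auto

lemma output_index_eq_standard: "output_index \<sigma> G \<mu> = standard \<sigma> G"
proof (intro equalityI subsetI)
  fix \<beta> assume "\<beta> \<in> output_index \<sigma> G \<mu>"
  then show "\<beta> \<in> standard \<sigma> G"
    by (auto simp: output_index_def nf_coeff_def intro: lookup_normal_form_nonzero)
next
  fix \<beta> assume \<beta>: "\<beta> \<in> standard \<sigma> G"
  \<comment> \<open>At the unit vector of \<beta> the Taylor polynomial is x^\<beta>, its own normal
    form; hence d_\<beta> is not the zero form.\<close>
  have "nf_coeff \<sigma> G \<mu> \<beta> (\<lambda>t. if t = \<beta> then 1 else 0) = 1"
    by (simp add: nf_coeff_def generic_taylor_unit total_deg_standard_less normal_form_standard \<beta>)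
  then have "nf_coeff \<sigma> G \<mu> \<beta> (\<lambda>t. if t = \<beta> then 1 else 0) \<noteq> 0"
    by simp
  then show "\<beta> \<in> output_index \<sigma> G \<mu>"
    unfolding output_index_def by (intro CollectI exI)
qed

lemma normal_form_truncation:
  "normal_form \<sigma> G (generic_taylor \<mu> (Poly_Mapping.lookup f)) = normal_form \<sigma> G f"
proof (rule normal_form_eqI[OF ordering subspace groebner])
  let ?h = "generic_taylor \<mu> (Poly_Mapping.lookup f)"
  have "(f - normal_form \<sigma> G f) - (f - ?h) \<in> I"
    by (rule ideal.subspace_diff[OF subspace diff_normal_form[OF ordering subspace groebner]
          diff_generic_taylor_in_ideal[OF subspace high_degree_in_I]])
  then show "?h - normal_form \<sigma> G f \<in> I"
    by simp
qed (rule keys_normal_form[OF ordering subspace groebner])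

lemma normal_form_eq_0_iff: "normal_form \<sigma> G f = 0 \<longleftrightarrow> f \<in> I"
  using diff_normal_form[OF ordering subspace groebner, of f]
    normal_form_eqI[OF ordering subspace groebner, of f 0]
  by auto

section \<open>Duality between the output and the standard monomials\<close>

context
  fixes a
  assumes a: "represents_nf \<sigma> G \<mu> a"
begin

text \<open>Since \<open>D \<alpha>\<close> yields the coefficient of x^\<alpha> in f at the origin,
  the value of L_\<beta> there is d_\<beta> with these coefficients substituted for the
  c_\<alpha>.\<close>

lemma output_op_at_0: "eval (\<lambda>_. 0) (output_op \<mu> a \<beta> f) = Poly_Mapping.lookup (normal_form \<sigma> G f) \<beta>"
proof -
  have "eval (\<lambda>_. 0) (output_op \<mu> a \<beta> f) = nf_coeff \<sigma> G \<mu> \<beta> (Poly_Mapping.lookup f)"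
    using a by (simp add: represents_nf_def output_op_def eval_0_sum_op)
  then show ?thesis
    by (simp add: nf_coeff_def normal_form_truncation)
qed

lemma output_op_at_0_standard:
  "\<gamma> \<in> standard \<sigma> G \<Longrightarrow>
    eval (\<lambda>_. 0) (output_op \<mu> a \<beta> (Poly_Mapping.single \<gamma> 1)) = (if \<gamma> = \<beta> then 1 else 0)"
  by (simp add: output_op_at_0 normal_form_standard lookup_single when_def)

lemma inj_on_output_op: "inj_on (output_op \<mu> a) (standard \<sigma> G)"
  using output_op_at_0_standard by (intro inj_onI) (metis zero_neq_one)

lemma independent_output_op: "oper.independent (output_op \<mu> a ` standard \<sigma> G)"
proof
  assume "oper.dependent (output_op \<mu> a ` standard \<sigma> G)"
  then obtain u \<gamma> where \<gamma>: "\<gamma> \<in> standard \<sigma> G" "u (output_op \<mu> a \<gamma>) \<noteq> 0"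
    and u: "(\<Sum>\<beta>\<in>standard \<sigma> G. oscale (u (output_op \<mu> a \<beta>)) (output_op \<mu> a \<beta>)) = 0"
    using finite_standard inj_on_output_op by (auto simp: oper.dependent_finite sum.reindex)
  have "eval (\<lambda>_. 0) ((\<Sum>\<beta>\<in>standard \<sigma> G. oscale (u (output_op \<mu> a \<beta>)) (output_op \<mu> a \<beta>))
      (Poly_Mapping.single \<gamma> 1)) = u (output_op \<mu> a \<gamma>)"
    using \<gamma>(1) finite_standard
    by (simp add: eval_0_sum_op output_op_at_0_standard if_distrib cong: if_cong)
  then show False
    using \<gamma>(2) unfolding u by (simp add: eval_0)
qed

lemma output_op_in_Delta: "output_op \<mu> a \<beta> \<in> Delta I"
  by (simp add: Delta_def output_op_in_diff_ops output_op_at_0 flip: normal_form_eq_0_iff)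

text \<open>Duality forces the coordinates: at a standard x^\<beta> only the summand of L_\<beta>
  survives. They suffice because L vanishes at the origin on f minus its normal form, and the normal
  form is a combination of standard monomials.\<close>

lemma Delta_expansion:
  assumes L: "L \<in> Delta I"
  shows "L = (\<Sum>\<beta>\<in>standard \<sigma> G.
    oscale (eval (\<lambda>_. 0) (L (Poly_Mapping.single \<beta> 1))) (output_op \<mu> a \<beta>))" (is "L = ?L'")
proof -
  have L_diff: "L \<in> diff_ops" and L_vanish: "\<And>f. f \<in> I \<Longrightarrow> eval (\<lambda>_. 0) (L f) = 0"
    using L by (auto simp: Delta_def)
  have "?L' \<in> diff_ops"
    using output_op_in_diff_ops unfolding diff_ops_def by (intro oper.span_sum oper.span_scale)
  then have "L - ?L' \<in> diff_ops"
    using L_diff unfolding diff_ops_def by (intro oper.span_diff)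
  moreover have "eval (\<lambda>_. 0) ((L - ?L') f) = 0" for f
  proof -
    let ?r = "normal_form \<sigma> G f"
    have "eval (\<lambda>_. 0) (L f) = eval (\<lambda>_. 0) (L ?r)"
      using L_vanish[OF diff_normal_form[OF ordering subspace groebner, of f]]
      by (simp add: diff_op_at_0_diff[OF L_diff])
    also have "\<dots> = (\<Sum>t\<in>Poly_Mapping.keys ?r.
        Poly_Mapping.lookup ?r t * eval (\<lambda>_. 0) (L (Poly_Mapping.single t 1)))"
      by (rule diff_op_at_0_expansion[OF L_diff])
    also have "\<dots> = (\<Sum>t\<in>standard \<sigma> G.
        Poly_Mapping.lookup ?r t * eval (\<lambda>_. 0) (L (Poly_Mapping.single t 1)))"
      using keys_normal_form[OF ordering subspace groebner] finite_standard
      by (intro sum.mono_neutral_left) (auto simp: in_keys_iff)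
    also have "\<dots> = eval (\<lambda>_. 0) (?L' f)"
      by (simp add: eval_0_sum_op output_op_at_0 mult.commute)
    finally show ?thesis
      by (simp add: eval_0 lookup_minus)
  qed
  ultimately have "L - ?L' = 0"
    by (rule diff_op_eq_0)
  then show ?thesis
    by simp
qed

lemma span_output_op: "oper.span (output_op \<mu> a ` standard \<sigma> G) = Delta I"
proof
  have "oper.subspace (Delta I)"
    unfolding Delta_def diff_ops_def
    by (rule oper.subspaceI)
       (simp_all add: oper.span_zero oper.span_add oper.span_scale, simp_all add: eval_0 lookup_add)
  then show "oper.span (output_op \<mu> a ` standard \<sigma> G) \<subseteq> Delta I"
    using output_op_in_Delta by (intro oper.span_minimal) auto
  show "Delta I \<subseteq> oper.span (output_op \<mu> a ` standard \<sigma> G)"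
  proof
    fix L assume "L \<in> Delta I"
    then show "L \<in> oper.span (output_op \<mu> a ` standard \<sigma> G)"
      by (subst Delta_expansion) (auto intro!: oper.span_sum oper.span_scale intro: oper.span_base)
  qed
qed

lemma noetherian_output_op: "noetherian_operators I (output_op \<mu> a ` standard \<sigma> G)"
proof -
  have "f \<in> I" if "\<forall>\<beta>\<in>standard \<sigma> G. eval (\<lambda>_. 0) (output_op \<mu> a \<beta> f) = 0" for f
  proof -
    \<comment> \<open>The operators test the standard exponents; at all others the normal form has
      coefficient 0 anyway.\<close>
    have "Poly_Mapping.lookup (normal_form \<sigma> G f) t = 0" for t
      using that lookup_normal_form_nonzero[of f t] by (auto simp: output_op_at_0)
    then have "normal_form \<sigma> G f = 0"
      by (intro poly_mapping_eqI) simp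
    then show ?thesis
      by (simp add: normal_form_eq_0_iff)
  qed
  moreover have "eval (\<lambda>_. 0) (output_op \<mu> a \<beta> f) = 0" if "f \<in> I" for f \<beta>
    using that by (simp add: output_op_at_0 flip: normal_form_eq_0_iff)
  ultimately show ?thesis
    using finite_standard output_op_in_diff_ops by (auto simp: noetherian_operators_def)
qed

end

end

text \<open>Finding the scalars is a step of the procedure, so their existence and the correctness
  for every admissible choice are separate conjuncts. Injectivity records that distinct \<beta>
  return distinct operators, so passing to the set S loses none.\<close>

theorem mainTheorem1:
  fixes \<sigma> :: "'n::finite pp rel" and I G :: "'n mpoly set"
  assumes "term_ordering \<sigma>"
    and "primary_ideal I"
    and "zero_dimensional I"
    and "zero_set I = {\<lambda>_. 0}"
    and "groebner_basis \<sigma> I G"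
  shows "let \<mu> = quotient_dim I in
    (\<exists>a. represents_nf \<sigma> G \<mu> a) \<and>
    (\<forall>a. represents_nf \<sigma> G \<mu> a \<longrightarrow>
       (let B = output_index \<sigma> G \<mu>; S = output_op \<mu> a ` B in
          finite B \<and> inj_on (output_op \<mu> a) B \<and> card S = \<mu> \<and>
          oper.independent S \<and> oper.span S = Delta I \<and>
          noetherian_operators I S))"
proof -
  have "(\<lambda>_. 0) \<in> zero_set I"
    using assms(4) by simp
  note hyps = assms(1-3) this assms(5)
  have "\<exists>a. represents_nf \<sigma> G (quotient_dim I) a"
    unfolding represents_nf_def
    by (intro exI[of _ "\<lambda>\<beta> \<alpha>. Poly_Mapping.lookup (normal_form \<sigma> G (Poly_Mapping.single \<alpha> 1)) \<beta>"]
        allI nf_coeff_eq[OF hyps])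
  then show ?thesis
    by (simp add: Let_def output_index_eq_standard[OF hyps] finite_standard[OF hyps]
        card_standard[OF hyps] inj_on_output_op[OF hyps] card_image independent_output_op[OF hyps]
        span_output_op[OF hyps] noetherian_output_op[OF hyps])
qed

end
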